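(* Let $d\ge2$. There exists a rational function $f\in A(\mathbb{B}_d)$ with $f(0)=0$ and $\|f\|_\infty=1$ that cannot be written as $f=\sum_{i=1}^dz_if_i$ with $f_1,\ldots,f_d\in H^\infty(\mathbb{B}_d)$ and $\sup_{z\in\mathbb{B}_d}\sum_{i=1}^d|f_i(z)|^2\le1$.
   Context: $\mathbb{B}_d$ is the open Euclidean unit ball of $\mathbb{C}^d$. $H^\infty(\mathbb{B}_d)$ is the algebra of bounded holomorphic functions on $\mathbb{B}_d$ with $\|f\|_\infty=\sup_{z\in\mathbb{B}_d}|f(z)|$. $A(\mathbb{B}_d)$ is the ball algebra: holomorphic functions on $\mathbb{B}_d$ that extend continuously to $\overline{\mathbb{B}}_d$. *)

theory Defs
  imports "HOL-Analysis.Analysis"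
begin

text \<open>
  \<open>\<complex>\<^sup>d\<close> is the type \<open>complex ^ 'n\<close> with \<open>d = CARD('n)\<close>. Its norm is the Euclidean one, so the open
  unit ball is \<open>ball 0 1\<close>. Functions on the ball are represented by total functions whose values
  outside the ball are irrelevant.
\<close>

abbreviation unit_ball :: "(complex ^ 'n) set"
  where "unit_ball \<equiv> ball 0 1"

text \<open>
  Holomorphy in several variables is complex differentiability: the real Frechet derivative exists
  and is complex linear (additivity is part of \<open>has_derivative\<close>).
\<close>

definition holomorphic_vec_on :: "(complex ^ 'n \<Rightarrow> complex) \<Rightarrow> (complex ^ 'n) set \<Rightarrow> bool"
  where "holomorphic_vec_on f S \<longleftrightarrow>
    (\<forall>z\<in>S. \<exists>D. (f has_derivative D) (at z within S) \<and> (\<forall>c v. D (c *s v) = c * D v))"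

definition H_infinity :: "(complex ^ 'n \<Rightarrow> complex) set"
  where "H_infinity = {f. holomorphic_vec_on f unit_ball \<and> bounded (f ` unit_ball)}"

definition sup_norm :: "(complex ^ 'n \<Rightarrow> complex) \<Rightarrow> real"
  where "sup_norm f = (SUP z\<in>unit_ball. norm (f z))"

definition ball_algebra :: "(complex ^ 'n \<Rightarrow> complex) set"
  where "ball_algebra = {f. holomorphic_vec_on f unit_ball \<and>
    (\<exists>g. continuous_on (cball 0 1) g \<and> (\<forall>z\<in>unit_ball. g z = f z))}"

definition poly_fun :: "(complex ^ 'n \<Rightarrow> complex) \<Rightarrow> bool"
  where "poly_fun p \<longleftrightarrow>
    (\<exists>(A :: ('n \<Rightarrow> nat) set) c. finite A \<and>
      p = (\<lambda>z. \<Sum>\<alpha>\<in>A. c \<alpha> * (\<Prod>i\<in>UNIV. (z $ i) ^ \<alpha> i)))"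

text \<open>
  A rational function that is holomorphic on the ball has a denominator without zeros there when
  written in lowest terms; zeros of the denominator on the sphere are allowed.
\<close>

definition rational_on_ball :: "(complex ^ 'n \<Rightarrow> complex) \<Rightarrow> bool"
  where "rational_on_ball f \<longleftrightarrow>
    (\<exists>p q. poly_fun p \<and> poly_fun q \<and> (\<forall>z\<in>unit_ball. q z \<noteq> 0 \<and> f z = p z / q z))"

end

theory Submission
  imports Defs "HOL-Complex_Analysis.Conformal_Mappings"
begin

text \<open>
  For two distinct coordinates \<open>a\<close> and \<open>b\<close> the polynomial \<open>f z = z\<^sub>a + z\<^sub>b\<^sup>2 / 2\<close> is already a
  counterexample. On the ball \<open>\<bar>z\<^sub>b\<bar>\<^sup>2 \<le> 1 - \<bar>z\<^sub>a\<bar>\<^sup>2\<close>, so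
  \<open>\<bar>f z\<bar> \<le> \<bar>z\<^sub>a\<bar> + (1 - \<bar>z\<^sub>a\<bar>\<^sup>2) / 2 = 1 - (1 - \<bar>z\<^sub>a\<bar>)\<^sup>2 / 2 \<le> 1\<close>; and along the \<open>a\<close>-th axis
  \<open>f\<close> is the coordinate itself, so the bound \<open>1\<close> is the supremum.

  Suppose \<open>f = (\<Sum>i. z\<^sub>i F\<^sub>i)\<close> with \<open>(\<Sum>i. \<bar>F\<^sub>i\<bar>\<^sup>2) \<le> 1\<close>. On the \<open>a\<close>-th axis the identity reads
  \<open>z\<^sub>a = z\<^sub>a F\<^sub>a\<close>, so \<open>F\<^sub>a\<close> takes the value \<open>1\<close>, the largest modulus that it may have, at an interior
  point. By the maximum principle \<open>F\<^sub>a\<close> is constantly \<open>1\<close>, which leaves no room for the other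
  \<open>F\<^sub>i\<close>: they vanish and \<open>f z = z\<^sub>a\<close>. This is wrong off the hyperplane \<open>z\<^sub>b = 0\<close>. So the
  obstruction is that a norm one function on the ball which agrees with a coordinate on a complex line
  through the centre need not agree with it everywhere, whereas a contractive solution would force it to.
\<close>

section \<open>The maximum principle in several variables\<close>

lemma bounded_linear_vector_scalar_mult_left:
  fixes v :: "complex ^ 'n"
  shows "bounded_linear (\<lambda>t::complex. t *s v)"
proof -
  have "linear (\<lambda>t::complex. t *s v)"
    by (rule linearI) (simp_all add: vec_eq_iff algebra_simps)
  then show ?thesis
    by (simp add: linear_conv_bounded_linear)
qed

lemma holomorphic_vec_on_imp_holomorphic_on_line:
  fixes f :: "complex ^ 'n \<Rightarrow> complex"
  assumes f: "holomorphic_vec_on f U" and U: "open U"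
  shows "(\<lambda>t. f (z + t *s v)) holomorphic_on {t. z + t *s v \<in> U}"
  unfolding holomorphic_on_def field_differentiable_def
proof (intro ballI)
  fix t assume "t \<in> {t. z + t *s v \<in> U}"
  then have t: "z + t *s v \<in> U" by simp
  then obtain D where D: "(f has_derivative D) (at (z + t *s v))"
    and lin: "\<And>c w. D (c *s w) = c * D w"
    using f at_within_open[OF t U] unfolding holomorphic_vec_on_def by metis
  have "((\<lambda>t. z + t *s v) has_derivative (\<lambda>h. h *s v)) (at t)"
    using has_derivative_add[OF has_derivative_const
        bounded_linear_imp_has_derivative[OF bounded_linear_vector_scalar_mult_left]]
    by simp
  from has_derivative_compose[OF this D]
  have "((\<lambda>t. f (z + t *s v)) has_derivative (\<lambda>h. D v * h)) (at t)"
    by (simp add: lin mult.commute)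
  then have "((\<lambda>t. f (z + t *s v)) has_field_derivative D v) (at t)"
    by (simp add: has_field_derivative_def)
  then show "\<exists>f'. ((\<lambda>t. f (z + t *s v)) has_field_derivative f')
      (at t within {t. z + t *s v \<in> U})"
    using has_field_derivative_at_within by blast
qed

text \<open>
  Any two points of a convex set lie on a complex line that meets the set in a convex, hence
  connected, part; on it the one-variable principle applies.
\<close>

lemma maximum_modulus_principle_vec:
  fixes f :: "complex ^ 'n \<Rightarrow> complex"
  assumes f: "holomorphic_vec_on f U" and U: "open U" "convex U"
    and z: "z \<in> U" and w: "w \<in> U"
    and max: "\<And>x. x \<in> U \<Longrightarrow> norm (f x) \<le> norm (f z)"
  shows "f w = f z"
proof -
  define v where "v = w - z"
  define T where "T = {t. z + t *s v \<in> U}"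
  have T_eq: "T = (\<lambda>t. t *s v) -` ((+) (- z) ` U)"
    by (force simp: T_def image_iff)
  note bl = bounded_linear_vector_scalar_mult_left[of v]
  have "open T"
    unfolding T_eq using bl U(1)
    by (intro open_vimage open_translation linear_continuous_on)
  moreover have "connected T"
    unfolding T_eq using bl U(2)
    by (intro convex_connected convex_linear_vimage convex_translation bounded_linear.linear)
  moreover have "0 \<in> T" "1 \<in> T"
    using z w by (simp_all add: T_def v_def)
  moreover have "(\<lambda>t. f (z + t *s v)) holomorphic_on T"
    unfolding T_def by (rule holomorphic_vec_on_imp_holomorphic_on_line[OF f U(1)])
  moreover have "norm (f (z + t *s v)) \<le> norm (f (z + 0 *s v))" if "t \<in> T" for t
    using max that by (simp add: T_def)
  ultimately have "(\<lambda>t. f (z + t *s v)) constant_on T"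
    by (intro maximum_modulus_principle[where S = T and U = T and \<xi> = 0]) auto
  then obtain c where "\<And>t. t \<in> T \<Longrightarrow> f (z + t *s v) = c"
    unfolding constant_on_def by blast
  from this[OF \<open>0 \<in> T\<close>] this[OF \<open>1 \<in> T\<close>] show ?thesis
    by (simp add: v_def)
qed

section \<open>The extremal polynomial\<close>

definition tilted_coordinate :: "'n \<Rightarrow> 'n \<Rightarrow> complex ^ 'n \<Rightarrow> complex"
  where "tilted_coordinate a b z = z $ a + (z $ b)\<^sup>2 / 2"

lemma norm_sq_two_components_le:
  fixes z :: "complex ^ 'n"
  assumes "a \<noteq> b"
  shows "(norm (z $ a))\<^sup>2 + (norm (z $ b))\<^sup>2 \<le> (norm z)\<^sup>2"
proof -
  have "(\<Sum>i\<in>{a, b}. (norm (z $ i))\<^sup>2) \<le> (\<Sum>i\<in>UNIV. (norm (z $ i))\<^sup>2)"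
    by (rule sum_mono2) auto
  then show ?thesis
    using assms by (simp add: norm_vec_def L2_set_def sum_nonneg)
qed

lemma norm_axis_complex [simp]: "norm (axis a c :: complex ^ 'n) = norm c"
proof -
  have "(\<Sum>i\<in>UNIV. (norm (axis a c $ i))\<^sup>2) = (norm c)\<^sup>2"
    by (simp add: axis_def if_distrib[of norm] if_distrib[of "\<lambda>x. x\<^sup>2"] cong: if_cong)
  then show ?thesis
    by (simp add: norm_vec_def L2_set_def)
qed

text \<open>The estimate amounts to \<open>0 \<le> (1 - \<bar>z\<^sub>a\<bar>)\<^sup>2\<close>.\<close>

lemma norm_tilted_coordinate_le:
  fixes z :: "complex ^ 'n"
  assumes "a \<noteq> b" "z \<in> unit_ball"
  shows "norm (tilted_coordinate a b z) \<le> 1"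
proof -
  have "(norm z)\<^sup>2 \<le> 1"
    using assms(2) by (simp add: power_le_one)
  then have "(norm (z $ b))\<^sup>2 \<le> 1 - (norm (z $ a))\<^sup>2"
    using norm_sq_two_components_le[OF assms(1), of z] by simp
  moreover have "norm (tilted_coordinate a b z) \<le> norm (z $ a) + (norm (z $ b))\<^sup>2 / 2"
    unfolding tilted_coordinate_def
    using norm_triangle_ineq[of "z $ a" "(z $ b)\<^sup>2 / 2"] by (simp add: norm_divide norm_power)
  moreover have "0 \<le> (1 - norm (z $ a))\<^sup>2"
    by simp
  ultimately show ?thesis
    by (simp add: power2_eq_square algebra_simps)
qed

lemma sup_norm_tilted_coordinate:
  fixes a b :: "'n::finite"
  assumes "a \<noteq> b"
  shows "sup_norm (tilted_coordinate a b) = 1"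
  unfolding sup_norm_def
proof (rule antisym)
  show "(SUP z\<in>unit_ball. norm (tilted_coordinate a b z)) \<le> 1"
    using norm_tilted_coordinate_le[OF assms] by (intro cSUP_least) auto
  have bdd: "bdd_above ((\<lambda>z. norm (tilted_coordinate a b z)) ` unit_ball)"
    using norm_tilted_coordinate_le[OF assms] by (intro bdd_aboveI2) auto
  show "1 \<le> (SUP z\<in>unit_ball. norm (tilted_coordinate a b z))"
  proof (rule dense_le_bounded[of 0])
    fix r :: real assume r: "0 < r" "r < 1"
    have "norm (tilted_coordinate a b (axis a (of_real r))) = r"
      using assms r by (simp add: tilted_coordinate_def axis_def)
    moreover have "axis a (of_real r) \<in> unit_ball"
      using r by simp
    ultimately show "r \<le> (SUP z\<in>unit_ball. norm (tilted_coordinate a b z))"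
      using cSUP_upper[OF _ bdd] by metis
  qed simp
qed

lemma tilted_coordinate_has_derivative:
  "(tilted_coordinate a b has_derivative (\<lambda>v. v $ a + z $ b * v $ b)) (at z within S)"
proof -
  have "((\<lambda>z. z $ a + (z $ b)\<^sup>2 / 2) has_derivative (\<lambda>v. v $ a + z $ b * v $ b)) (at z within S)"
    by (auto intro!: derivative_eq_intros bounded_linear.has_derivative[OF bounded_linear_vec_nth])
  then show ?thesis
    by (simp add: tilted_coordinate_def[abs_def])
qed

lemma tilted_coordinate_in_ball_algebra: "tilted_coordinate a b \<in> ball_algebra"
proof -
  have "holomorphic_vec_on (tilted_coordinate a b) unit_ball"
    unfolding holomorphic_vec_on_def
  proof (intro ballI exI conjI allI)
    show "(tilted_coordinate a b has_derivative (\<lambda>v. v $ a + z $ b * v $ b))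
      (at z within unit_ball)" for z
      by (rule tilted_coordinate_has_derivative)
  qed (simp add: algebra_simps)
  moreover have "continuous_on (cball 0 1) (tilted_coordinate a b)"
    by (meson has_derivative_continuous_on tilted_coordinate_has_derivative)
  ultimately show ?thesis
    unfolding ball_algebra_def by blast
qed

lemma poly_fun_one: "poly_fun (\<lambda>z. 1)"
  unfolding poly_fun_def by (rule exI[of _ "{\<lambda>_. 0}"], rule exI[of _ "\<lambda>_. 1"]) simp

lemma poly_fun_tilted_coordinate:
  fixes a b :: "'n::finite"
  shows "poly_fun (tilted_coordinate a b)"
proof -
  define \<alpha> :: "'n \<Rightarrow> nat" where "\<alpha> = (\<lambda>i. if i = a then 1 else 0)"
  define \<beta> :: "'n \<Rightarrow> nat" where "\<beta> = (\<lambda>i. if i = b then 2 else 0)"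
  have "\<alpha> a \<noteq> \<beta> a"
    by (simp add: \<alpha>_def \<beta>_def)
  then have "\<alpha> \<noteq> \<beta>"
    by metis
  have \<alpha>: "(\<Prod>i\<in>UNIV. (z $ i) ^ \<alpha> i) = z $ a" for z :: "complex ^ 'n"
    by (simp add: \<alpha>_def if_distrib[of "\<lambda>k. _ ^ k"] cong: if_cong)
  have \<beta>: "(\<Prod>i\<in>UNIV. (z $ i) ^ \<beta> i) = (z $ b)\<^sup>2" for z :: "complex ^ 'n"
    by (simp add: \<beta>_def if_distrib[of "\<lambda>k. _ ^ k"] cong: if_cong)
  have "tilted_coordinate a b =
      (\<lambda>z. \<Sum>\<gamma>\<in>{\<alpha>, \<beta>}. (if \<gamma> = \<alpha> then 1 else 1 / 2) * (\<Prod>i\<in>UNIV. (z $ i) ^ \<gamma> i))"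
    using \<open>\<alpha> \<noteq> \<beta>\<close> by (auto simp: fun_eq_iff tilted_coordinate_def \<alpha> \<beta>)
  then show ?thesis
    unfolding poly_fun_def
    by (intro exI[of _ "{\<alpha>, \<beta>}"] exI[of _ "\<lambda>\<gamma>. if \<gamma> = \<alpha> then 1 else 1 / 2"]) simp
qed

lemma rational_on_ball_tilted_coordinate: "rational_on_ball (tilted_coordinate a b)"
  unfolding rational_on_ball_def
  by (rule exI[of _ "tilted_coordinate a b"], rule exI[of _ "\<lambda>z. 1"])
    (simp add: poly_fun_tilted_coordinate poly_fun_one)

section \<open>The failure of the contractive Gleason problem\<close>

text \<open>
  A supremum of reals bounds its members only if they are bounded above, which is where the
  boundedness of the \<open>F\<^sub>i\<close> enters.
\<close>

lemma sum_norm_sq_le_Sup: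
  fixes F :: "'n::finite \<Rightarrow> complex ^ 'n \<Rightarrow> complex"
  assumes F: "\<And>i. F i \<in> H_infinity" and z: "z \<in> unit_ball"
  shows "(\<Sum>i\<in>UNIV. (norm (F i z))\<^sup>2) \<le> (SUP z\<in>unit_ball. \<Sum>i\<in>UNIV. (norm (F i z))\<^sup>2)"
proof (rule cSUP_upper[OF z])
  have "\<exists>B. \<forall>z\<in>unit_ball. norm (F i z) \<le> B" for i
    using F[of i] by (auto simp: H_infinity_def bounded_iff)
  then obtain B where B: "\<And>i z. z \<in> unit_ball \<Longrightarrow> norm (F i z) \<le> B i"
    by metis
  show "bdd_above ((\<lambda>z. \<Sum>i\<in>UNIV. (norm (F i z))\<^sup>2) ` unit_ball)"
    by (rule bdd_aboveI2[where M = "\<Sum>i\<in>UNIV. (B i)\<^sup>2"]) (intro sum_mono power_mono B, auto)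
qed

theorem proposition5p1:
  assumes "CARD('n::finite) \<ge> 2"
  shows "\<exists>f :: complex ^ 'n \<Rightarrow> complex.
    rational_on_ball f \<and> f \<in> ball_algebra \<and> f 0 = 0 \<and> sup_norm f = 1 \<and>
    \<not> (\<exists>F :: 'n \<Rightarrow> complex ^ 'n \<Rightarrow> complex.
          (\<forall>i. F i \<in> H_infinity) \<and>
          (\<forall>z\<in>unit_ball. f z = (\<Sum>i\<in>UNIV. z $ i * F i z)) \<and>
          (SUP z\<in>unit_ball. \<Sum>i\<in>UNIV. (norm (F i z))\<^sup>2) \<le> 1)"
proof -
  obtain a b :: 'n where ab: "a \<noteq> b"
    using assms by (metis card_2_iff ex_card insertCI)
  let ?f = "tilted_coordinate a b"
  have False
    if F: "\<And>i. F i \<in> H_infinity"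
      and f: "\<And>z. z \<in> unit_ball \<Longrightarrow> ?f z = (\<Sum>i\<in>UNIV. z $ i * F i z)"
      and Sup: "(SUP z\<in>unit_ball. \<Sum>i\<in>UNIV. (norm (F i z))\<^sup>2) \<le> 1"
    for F :: "'n \<Rightarrow> complex ^ 'n \<Rightarrow> complex"
  proof -
    have sum_le: "(\<Sum>i\<in>UNIV. (norm (F i z))\<^sup>2) \<le> 1" if "z \<in> unit_ball" for z
      using sum_norm_sq_le_Sup[of F, OF F that] Sup by linarith
    have sum_axis: "(\<Sum>i\<in>UNIV. axis j c $ i * G i) = c * G j"
      for j :: 'n and c and G :: "'n \<Rightarrow> complex"
      by (simp add: axis_def if_distrib[of "\<lambda>x. x * _"] cong: if_cong)
    define z :: "complex ^ 'n" where "z = axis a (1 / 2)"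
    define w :: "complex ^ 'n" where "w = axis b (1 / 2)"
    have z: "z \<in> unit_ball" and w: "w \<in> unit_ball"
      by (simp_all add: z_def w_def norm_divide)
    have "?f z = 1 / 2"
      using ab by (simp add: tilted_coordinate_def z_def axis_def)
    then have Fa: "F a z = 1"
      using f[OF z] by (simp add: z_def sum_axis)
    have "norm (F a x) \<le> norm (F a z)" if "x \<in> unit_ball" for x
    proof -
      have "(norm (F a x))\<^sup>2 \<le> (\<Sum>i\<in>UNIV. (norm (F i x))\<^sup>2)"
        by (rule member_le_sum) auto
      then have "(norm (F a x))\<^sup>2 \<le> 1"
        using sum_le[OF that] by linarith
      then show ?thesis
        by (simp add: Fa power2_le_iff_abs_le abs_le_square_iff abs_square_le_1)
    qed
    moreover have "holomorphic_vec_on (F a) unit_ball"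
      using F by (simp add: H_infinity_def)
    ultimately have "F a w = F a z"
      using z w by (intro maximum_modulus_principle_vec[where U = unit_ball]) auto
    then have "(norm (F b w))\<^sup>2 + 1 \<le> (\<Sum>i\<in>UNIV. (norm (F i w))\<^sup>2)"
      using sum_mono2[of UNIV "{b, a}" "\<lambda>i. (norm (F i w))\<^sup>2"] ab Fa by simp
    then have "(norm (F b w))\<^sup>2 \<le> 0"
      using sum_le[OF w] by linarith
    then have "F b w = 0"
      by simp
    then have "?f w = 0"
      using f[OF w] by (simp add: w_def sum_axis)
    moreover have "?f w = 1 / 8"
      using ab by (simp add: tilted_coordinate_def w_def axis_def power2_eq_square)
    ultimately show False
      by simp
  qed
  moreover have "?f 0 = 0"
    by (simp add: tilted_coordinate_def)
  ultimately show ?thesis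
    using rational_on_ball_tilted_coordinate tilted_coordinate_in_ball_algebra
      sup_norm_tilted_coordinate[OF ab]
    by blast
qed

end
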